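(* Let $P$ be an infinite field and let $F=F(x,y)$ be the free Lie algebra over $P$ on two free generators. Then every automorphism $\varphi$ of the semigroup $\mathrm{End}(F)$ is semi-inner; that is, there is a semi-automorphism $(\sigma,s):F\to F$ such that $\varphi(\nu)=s\nu s^{-1}$ for every $\nu\in\mathrm{End}(F)$.
   Context: $\mathrm{End}(F)$ is the semigroup (under composition) of Lie $P$-algebra endomorphisms of $F$. A semi-automorphism $(\sigma,s)$ of $F$ consists of $\sigma\in\mathrm{Aut}(P)$ and a bijective homomorphism of Lie rings $s:F\to F$ with $s(\lambda a)=\sigma(\lambda)s(a)$ for all $\lambda\in P$, $a\in F$. *)

theory Defs
  imports Complex_Main "HOL-Algebra.Group"
begin

locale lie_algebra = vector_space scale
  for scale :: "'p::field \<Rightarrow> 'a::ab_group_add \<Rightarrow> 'a" +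
  fixes bracket :: "'a \<Rightarrow> 'a \<Rightarrow> 'a"
  assumes bracket_add_left: "bracket (a + b) c = bracket a c + bracket b c"
    and bracket_add_right: "bracket a (b + c) = bracket a b + bracket a c"
    and bracket_scale_left: "bracket (scale r a) b = scale r (bracket a b)"
    and bracket_scale_right: "bracket a (scale r b) = scale r (bracket a b)"
    and bracket_self: "bracket a a = 0"
    and jacobi:
      "bracket a (bracket b c) + bracket b (bracket c a) + bracket c (bracket a b) = 0"

definition lie_hom ::
  "('p::field \<Rightarrow> 'a::ab_group_add \<Rightarrow> 'a) \<Rightarrow> ('a \<Rightarrow> 'a \<Rightarrow> 'a) \<Rightarrow>
   ('p \<Rightarrow> 'b::ab_group_add \<Rightarrow> 'b) \<Rightarrow> ('b \<Rightarrow> 'b \<Rightarrow> 'b) \<Rightarrow> ('a \<Rightarrow> 'b) \<Rightarrow> bool"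
  where "lie_hom scale1 bracket1 scale2 bracket2 f \<longleftrightarrow>
    Vector_Spaces.linear scale1 scale2 f \<and>
    (\<forall>a b. f (bracket1 a b) = bracket2 (f a) (f b))"

text \<open>
  Endomorphisms under composition. Elements of \<open>iso\<close> are only required to be bijective on the
  carrier and to preserve multiplication, so automorphisms of this record are exactly
  automorphisms of the endomorphism semigroup; values outside the carrier are irrelevant.
\<close>

definition lie_End ::
  "('p::field \<Rightarrow> 'a::ab_group_add \<Rightarrow> 'a) \<Rightarrow> ('a \<Rightarrow> 'a \<Rightarrow> 'a) \<Rightarrow> ('a \<Rightarrow> 'a) monoid"
  where "lie_End scale bracket =
    \<lparr>carrier = {\<nu>. lie_hom scale bracket scale bracket \<nu>}, monoid.mult = (\<circ>), one = id\<rparr>"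

definition field_automorphism :: "('p::field \<Rightarrow> 'p) \<Rightarrow> bool"
  where "field_automorphism \<sigma> \<longleftrightarrow>
    bij \<sigma> \<and> \<sigma> 1 = 1 \<and> (\<forall>a b. \<sigma> (a + b) = \<sigma> a + \<sigma> b) \<and> (\<forall>a b. \<sigma> (a * b) = \<sigma> a * \<sigma> b)"

definition lie_semi_automorphism ::
  "('p::field \<Rightarrow> 'a::ab_group_add \<Rightarrow> 'a) \<Rightarrow> ('a \<Rightarrow> 'a \<Rightarrow> 'a) \<Rightarrow> ('p \<Rightarrow> 'p) \<Rightarrow> ('a \<Rightarrow> 'a) \<Rightarrow> bool"
  where "lie_semi_automorphism scale bracket \<sigma> s \<longleftrightarrow>
    field_automorphism \<sigma> \<and> bij s \<and>
    (\<forall>a b. s (a + b) = s a + s b) \<and>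
    (\<forall>a b. s (bracket a b) = bracket (s a) (s b)) \<and>
    (\<forall>r a. s (scale r a) = scale (\<sigma> r) (s a))"

text \<open>
  The free Lie algebra over the field \<open>'p\<close> on the set of generators \<open>'x\<close> is the algebra of all
  formal terms in the signature of Lie algebras, modulo the least congruence containing all
  instances of the Lie algebra axioms. That it is a Lie algebra with the universal property of
  the free one is proved below.
\<close>

datatype ('p, 'x) lie_term =
    LGen 'x
  | LZero
  | LNeg "('p, 'x) lie_term"
  | LAdd "('p, 'x) lie_term" "('p, 'x) lie_term"
  | LScale 'p "('p, 'x) lie_term"
  | LBracket "('p, 'x) lie_term" "('p, 'x) lie_term"

inductive lie_eq :: "('p::field, 'x) lie_term \<Rightarrow> ('p, 'x) lie_term \<Rightarrow> bool" where
  refl: "lie_eq t t"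
| sym: "lie_eq t u \<Longrightarrow> lie_eq u t"
| trans: "lie_eq t u \<Longrightarrow> lie_eq u v \<Longrightarrow> lie_eq t v"
| cong_neg: "lie_eq t t' \<Longrightarrow> lie_eq (LNeg t) (LNeg t')"
| cong_add: "lie_eq t t' \<Longrightarrow> lie_eq u u' \<Longrightarrow> lie_eq (LAdd t u) (LAdd t' u')"
| cong_scale: "lie_eq t t' \<Longrightarrow> lie_eq (LScale r t) (LScale r t')"
| cong_bracket: "lie_eq t t' \<Longrightarrow> lie_eq u u' \<Longrightarrow> lie_eq (LBracket t u) (LBracket t' u')"
| add_assoc: "lie_eq (LAdd (LAdd t u) v) (LAdd t (LAdd u v))"
| add_comm: "lie_eq (LAdd t u) (LAdd u t)"
| add_zero: "lie_eq (LAdd LZero t) t"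
| add_neg: "lie_eq (LAdd (LNeg t) t) LZero"
| scale_add_right: "lie_eq (LScale r (LAdd t u)) (LAdd (LScale r t) (LScale r u))"
| scale_add_left: "lie_eq (LScale (r + q) t) (LAdd (LScale r t) (LScale q t))"
| scale_scale: "lie_eq (LScale r (LScale q t)) (LScale (r * q) t)"
| scale_one: "lie_eq (LScale 1 t) t"
| bracket_add_left: "lie_eq (LBracket (LAdd t u) v) (LAdd (LBracket t v) (LBracket u v))"
| bracket_add_right: "lie_eq (LBracket t (LAdd u v)) (LAdd (LBracket t u) (LBracket t v))"
| bracket_scale_left: "lie_eq (LBracket (LScale r t) u) (LScale r (LBracket t u))"
| bracket_scale_right: "lie_eq (LBracket t (LScale r u)) (LScale r (LBracket t u))"
| bracket_self: "lie_eq (LBracket t t) LZero"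
| jacobi: "lie_eq (LAdd (LAdd (LBracket t (LBracket u v)) (LBracket u (LBracket v t)))
    (LBracket v (LBracket t u))) LZero"

quotient_type (overloaded) ('p, 'x) free_lie = "('p::field, 'x) lie_term" / lie_eq
  by (rule equivpI) (auto intro: reflpI sympI transpI lie_eq.refl lie_eq.sym lie_eq.trans)

instantiation free_lie :: (field, type) ab_group_add
begin

lift_definition zero_free_lie :: "('a, 'b) free_lie" is LZero .

lift_definition uminus_free_lie :: "('a, 'b) free_lie \<Rightarrow> ('a, 'b) free_lie" is LNeg
  by (rule lie_eq.cong_neg)

lift_definition plus_free_lie :: "('a, 'b) free_lie \<Rightarrow> ('a, 'b) free_lie \<Rightarrow> ('a, 'b) free_lie"
  is LAdd by (rule lie_eq.cong_add)

definition minus_free_lie :: "('a, 'b) free_lie \<Rightarrow> ('a, 'b) free_lie \<Rightarrow> ('a, 'b) free_lie"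
  where "minus_free_lie a b = a + (- b)"

instance
proof
  fix a b c :: "('a, 'b) free_lie"
  show "a + b + c = a + (b + c)" by transfer (rule lie_eq.add_assoc)
  show "a + b = b + a" by transfer (rule lie_eq.add_comm)
  show "0 + a = a" by transfer (rule lie_eq.add_zero)
  show "- a + a = 0" by transfer (rule lie_eq.add_neg)
  show "a - b = a + - b" by (rule minus_free_lie_def)
qed

end

lift_definition lie_gen :: "'x \<Rightarrow> ('p::field, 'x) free_lie" is LGen .

lift_definition lie_scale :: "'p::field \<Rightarrow> ('p, 'x) free_lie \<Rightarrow> ('p, 'x) free_lie" is LScale
  by (rule lie_eq.cong_scale)

lift_definition lie_bracket ::
  "('p::field, 'x) free_lie \<Rightarrow> ('p, 'x) free_lie \<Rightarrow> ('p, 'x) free_lie" is LBracket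
  by (rule lie_eq.cong_bracket)

interpretation free_lie: lie_algebra lie_scale lie_bracket
proof
  fix r q :: "'p::field" and a b c :: "('p, 'x) free_lie"
  show "lie_scale r (a + b) = lie_scale r a + lie_scale r b"
    by transfer (rule lie_eq.scale_add_right)
  show "lie_scale (r + q) a = lie_scale r a + lie_scale q a"
    by transfer (rule lie_eq.scale_add_left)
  show "lie_scale r (lie_scale q a) = lie_scale (r * q) a"
    by transfer (rule lie_eq.scale_scale)
  show "lie_scale 1 a = a"
    by transfer (rule lie_eq.scale_one)
  show "lie_bracket (a + b) c = lie_bracket a c + lie_bracket b c"
    by transfer (rule lie_eq.bracket_add_left)
  show "lie_bracket a (b + c) = lie_bracket a b + lie_bracket a c"
    by transfer (rule lie_eq.bracket_add_right)
  show "lie_bracket (lie_scale r a) b = lie_scale r (lie_bracket a b)"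
    by transfer (rule lie_eq.bracket_scale_left)
  show "lie_bracket a (lie_scale r b) = lie_scale r (lie_bracket a b)"
    by transfer (rule lie_eq.bracket_scale_right)
  show "lie_bracket a a = 0"
    by transfer (rule lie_eq.bracket_self)
  show "lie_bracket a (lie_bracket b c) + lie_bracket b (lie_bracket c a)
      + lie_bracket c (lie_bracket a b) = 0"
    by transfer (rule lie_eq.jacobi)
qed

lemma free_lie_induct [case_names gen zero neg add scale bracket, induct type: free_lie]:
  fixes a :: "('p::field, 'x) free_lie"
  assumes "\<And>x. Q (lie_gen x)" and "Q 0"
    and "\<And>a. Q a \<Longrightarrow> Q (- a)"
    and "\<And>a b. Q a \<Longrightarrow> Q b \<Longrightarrow> Q (a + b)"
    and "\<And>r a. Q a \<Longrightarrow> Q (lie_scale r a)"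
    and "\<And>a b. Q a \<Longrightarrow> Q b \<Longrightarrow> Q (lie_bracket a b)"
  shows "Q a"
proof -
  have "Q (abs_free_lie t)" for t
  proof (induction t)
    case (LGen x)
    then show ?case using assms(1)[of x] by (simp add: lie_gen.abs_eq)
  next
    case LZero
    then show ?case using assms(2) by (simp add: zero_free_lie.abs_eq)
  next
    case (LNeg t)
    then show ?case using assms(3)[of "abs_free_lie t"] by (simp add: uminus_free_lie.abs_eq)
  next
    case (LAdd t u)
    then show ?case using assms(4)[of "abs_free_lie t" "abs_free_lie u"]
      by (simp add: plus_free_lie.abs_eq)
  next
    case (LScale r t)
    then show ?case using assms(5)[of "abs_free_lie t" r] by (simp add: lie_scale.abs_eq)
  next
    case (LBracket t u)
    then show ?case using assms(6)[of "abs_free_lie t" "abs_free_lie u"]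
      by (simp add: lie_bracket.abs_eq)
  qed
  then show ?thesis
    by (metis Quotient3_abs_rep[OF Quotient3_free_lie])
qed

primrec lie_eval ::
  "('p::field \<Rightarrow> 'a::ab_group_add \<Rightarrow> 'a) \<Rightarrow> ('a \<Rightarrow> 'a \<Rightarrow> 'a) \<Rightarrow> ('x \<Rightarrow> 'a) \<Rightarrow> ('p, 'x) lie_term \<Rightarrow> 'a"
  where
  "lie_eval sc br f (LGen x) = f x"
| "lie_eval sc br f LZero = 0"
| "lie_eval sc br f (LNeg t) = - lie_eval sc br f t"
| "lie_eval sc br f (LAdd t u) = lie_eval sc br f t + lie_eval sc br f u"
| "lie_eval sc br f (LScale r t) = sc r (lie_eval sc br f t)"
| "lie_eval sc br f (LBracket t u) = br (lie_eval sc br f t) (lie_eval sc br f u)"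

lemma lie_eval_cong:
  assumes "lie_algebra sc br" and "lie_eq t u"
  shows "lie_eval sc br f t = lie_eval sc br f u"
proof -
  interpret lie_algebra sc br by (rule assms(1))
  note laws = scale_right_distrib scale_left_distrib bracket_add_left bracket_add_right
    bracket_scale_left bracket_scale_right bracket_self jacobi
  from assms(2) show ?thesis
  proof induction
    case (add_assoc t u v)
    show ?case unfolding lie_eval.simps by (rule add.assoc)
  next
    case (add_comm t u)
    show ?case unfolding lie_eval.simps by (rule add.commute)
  qed (simp_all add: laws)
qed

theorem free_lie_universal:
  fixes sc :: "'p::field \<Rightarrow> 'a::ab_group_add \<Rightarrow> 'a" and f :: "'x \<Rightarrow> 'a"
  assumes "lie_algebra sc br"
  shows "\<exists>!h. lie_hom lie_scale lie_bracket sc br h \<and> (\<forall>x. h (lie_gen x) = f x)"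
proof -
  interpret L: lie_algebra sc br by (rule assms)
  define h where "h a = lie_eval sc br f (rep_free_lie a)" for a
  have h_abs: "h (abs_free_lie t) = lie_eval sc br f t" for t
    unfolding h_def
    by (rule lie_eval_cong[OF assms Quotient3_rep_abs[OF Quotient3_free_lie lie_eq.refl]])
  have surj: "\<exists>t. a = abs_free_lie t" for a :: "('p, 'x) free_lie"
    by (metis Quotient3_abs_rep[OF Quotient3_free_lie])
  have add: "h (a + b) = h a + h b" for a b
    using surj[of a] surj[of b] by (auto simp: plus_free_lie.abs_eq h_abs)
  have scale: "h (lie_scale r a) = sc r (h a)" for r a
    using surj[of a] by (auto simp: lie_scale.abs_eq h_abs)
  have bracket: "h (lie_bracket a b) = br (h a) (h b)" for a b
    using surj[of a] surj[of b] by (auto simp: lie_bracket.abs_eq h_abs)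
  have gen: "h (lie_gen x) = f x" for x
    by (simp add: lie_gen.abs_eq h_abs)
  have "Vector_Spaces.linear lie_scale sc h"
    by unfold_locales (simp_all add: add scale)
  then have hom: "lie_hom lie_scale lie_bracket sc br h"
    by (simp add: lie_hom_def bracket)
  show ?thesis
  proof (rule ex1I[of _ h])
    show "lie_hom lie_scale lie_bracket sc br h \<and> (\<forall>x. h (lie_gen x) = f x)"
      using hom gen by simp
    fix g assume g: "lie_hom lie_scale lie_bracket sc br g \<and> (\<forall>x. g (lie_gen x) = f x)"
    then interpret G: Vector_Spaces.linear lie_scale sc g by (simp add: lie_hom_def)
    interpret H: Vector_Spaces.linear lie_scale sc h by fact
    show "g = h"
    proof
      fix a show "g a = h a"
        using g by (induction a)
          (simp_all add: lie_hom_def gen bracket G.add G.neg G.zero G.scale H.add H.neg H.zero H.scale)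
    qed
  qed
qed

datatype two_gens = GenX | GenY

type_synonym 'p free_lie2 = "('p, two_gens) free_lie"

abbreviation End_free_lie2 :: "('p::field free_lie2 \<Rightarrow> 'p free_lie2) monoid"
  where "End_free_lie2 \<equiv> lie_End lie_scale lie_bracket"

end

theory Submission
  imports Defs "HOL-Computational_Algebra.Polynomial"
begin

text \<open>
  Write \<open>L\<close> for the free Lie algebra on \<open>x, y\<close>, \<open>(a, b)\<close> for its endomorphism with \<open>x \<mapsto> a\<close> and
  \<open>y \<mapsto> b\<close>, and \<open>e = (x, 0)\<close>.

  Since \<open>a \<mapsto> (a, 0)\<close> identifies \<open>L\<close> with the left ideal \<open>End(L) e\<close>, an automorphism \<open>\<phi>\<close> of the
  semigroup is induced by a bijection of \<open>L\<close> as soon as \<open>End(L) \<phi>(e)\<close> is isomorphic to \<open>L\<close> as a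
  left \<open>End(L)\<close>-set as well. It is, because the idempotent \<open>\<phi>(e)\<close> is neither \<open>0\<close> nor \<open>id\<close>, and every
  idempotent other than \<open>id\<close> has the form \<open>(\<alpha>b, \<beta>b)\<close> and fixes \<open>b\<close> (\<open>idempotent_cases\<close>). The
  image of \<open>\<phi>(e)\<close> is then the line through some \<open>b \<noteq> 0\<close>, and \<open>s(a) = \<phi>((a, 0))(b)\<close> is a bijection
  with \<open>\<phi>(\<nu>) s = s \<nu>\<close> for all \<open>\<nu>\<close> (\<open>automorphism_induced_by_bijection\<close>).

  The elements \<open>s(x), s(y)\<close> freely generate \<open>L\<close>, so that composing \<open>s\<close> with an automorphism of \<open>L\<close>
  one may assume \<open>s(x) = x\<close> and \<open>s(y) = y\<close>. Then \<open>s(w(a, b)) = s(w)(s(a), s(b))\<close> for every Lie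
  polynomial \<open>w\<close>. Taking \<open>w = tx\<close> shows that \<open>s(ta) = \<sigma>(t) s(a)\<close> for a multiplicative bijection
  \<open>\<sigma>\<close> of the field. Hence \<open>s(x + y)\<close> and \<open>s([x, y])\<close> are homogeneous of degrees 1 and 2, which
  forces \<open>s(x + y) = x + y\<close> and \<open>s([x, y]) = c [x, y]\<close>. So \<open>s\<close> and \<open>\<sigma>\<close> are additive, and \<open>cs\<close>
  preserves brackets; rescaling \<open>s\<close> does not change the conjugation by \<open>s\<close>
  (\<open>normalising_bijection_semi_automorphism\<close>).

  The only structure of \<open>L\<close> that is needed is its grading by degree. Over an infinite field the
  homogeneous components of an element are unique because the dilations \<open>(tx, ty)\<close> act on degree
  \<open>n\<close> as multiplication by \<open>t\<^sup>n\<close>, so no basis of \<open>L\<close> and no embedding into an associative algebra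
  is required.
\<close>

section \<open>Endomorphisms as substitutions\<close>

abbreviation X :: "'p::field free_lie2" where "X \<equiv> lie_gen GenX"
abbreviation Y :: "'p::field free_lie2" where "Y \<equiv> lie_gen GenY"

abbreviation lie_endo :: "('p::field free_lie2 \<Rightarrow> 'p free_lie2) \<Rightarrow> bool"
  where "lie_endo \<equiv> lie_hom lie_scale lie_bracket lie_scale lie_bracket"

lemma carrier_End: "\<nu> \<in> carrier End_free_lie2 \<longleftrightarrow> lie_endo \<nu>"
  by (simp add: lie_End_def)

lemma lie_endo_add: "lie_endo \<nu> \<Longrightarrow> \<nu> (a + b) = \<nu> a + \<nu> b"
  and lie_endo_scale: "lie_endo \<nu> \<Longrightarrow> \<nu> (lie_scale r a) = lie_scale r (\<nu> a)"
  and lie_endo_bracket: "lie_endo \<nu> \<Longrightarrow> \<nu> (lie_bracket a b) = lie_bracket (\<nu> a) (\<nu> b)"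
  and lie_endo_zero: "lie_endo \<nu> \<Longrightarrow> \<nu> 0 = 0"
  and lie_endo_uminus: "lie_endo \<nu> \<Longrightarrow> \<nu> (- a) = - \<nu> a"
  and lie_endo_diff: "lie_endo \<nu> \<Longrightarrow> \<nu> (a - b) = \<nu> a - \<nu> b"
proof -
  assume "lie_endo \<nu>"
  then interpret Vector_Spaces.linear lie_scale lie_scale \<nu> by (simp add: lie_hom_def)
  show "\<nu> (a + b) = \<nu> a + \<nu> b" "\<nu> (lie_scale r a) = lie_scale r (\<nu> a)" "\<nu> 0 = 0"
    "\<nu> (- a) = - \<nu> a" "\<nu> (a - b) = \<nu> a - \<nu> b"
    by (simp_all add: add scale zero neg diff)
qed (simp add: lie_hom_def)

lemmas lie_endo_simps = lie_endo_add lie_endo_scale lie_endo_bracket lie_endo_zero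
  lie_endo_uminus lie_endo_diff

lemma lie_endoI:
  assumes "\<And>a b. \<nu> (a + b) = \<nu> a + \<nu> b" "\<And>r a. \<nu> (lie_scale r a) = lie_scale r (\<nu> a)"
    "\<And>a b. \<nu> (lie_bracket a b) = lie_bracket (\<nu> a) (\<nu> b)"
  shows "lie_endo \<nu>"
proof -
  have "Vector_Spaces.linear lie_scale lie_scale \<nu>"
    by unfold_locales (simp_all add: assms)
  then show ?thesis by (simp add: lie_hom_def assms)
qed

lemma lie_endo_comp: "lie_endo \<nu> \<Longrightarrow> lie_endo \<mu> \<Longrightarrow> lie_endo (\<nu> \<circ> \<mu>)"
  by (rule lie_endoI) (simp_all add: lie_endo_simps)

lemma lie_endo_id: "lie_endo id" and lie_endo_const_zero: "lie_endo (\<lambda>_. 0)"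
  by (rule lie_endoI; simp add: free_lie.bracket_self)+

lemma lie_endo_eqI:
  assumes "lie_endo \<nu>" "lie_endo \<mu>" "\<nu> X = \<mu> X" "\<nu> Y = \<mu> Y"
  shows "\<nu> = \<mu>"
proof
  fix a show "\<nu> a = \<mu> a"
  proof (induction a)
    case (gen g)
    then show ?case using assms(3,4) by (cases g) auto
  qed (simp_all add: lie_endo_simps assms(1,2))
qed

text \<open>
  The endomorphism with \<open>x \<mapsto> a\<close> and \<open>y \<mapsto> b\<close>; its value at \<open>c\<close> is the result of substituting
  \<open>a, b\<close> for the generators in \<open>c\<close>.
\<close>

definition subst :: "'p::field free_lie2 \<Rightarrow> 'p free_lie2 \<Rightarrow> 'p free_lie2 \<Rightarrow> 'p free_lie2"
  where "subst a b = (THE h. lie_endo h \<and> (\<forall>g. h (lie_gen g) = (case g of GenX \<Rightarrow> a | GenY \<Rightarrow> b)))"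

lemma lie_endo_subst: "lie_endo (subst a b)"
  and subst_X [simp]: "subst a b X = a"
  and subst_Y [simp]: "subst a b Y = b"
proof -
  have "lie_endo (subst a b) \<and>
      (\<forall>g. subst a b (lie_gen g) = (case g of GenX \<Rightarrow> a | GenY \<Rightarrow> b))"
    unfolding subst_def
    by (rule theI'[OF free_lie_universal[OF free_lie.lie_algebra_axioms,
            where f = "case_two_gens a b"]])
  then show "lie_endo (subst a b)" "subst a b X = a" "subst a b Y = b"
    by (auto split: two_gens.splits)
qed

lemmas subst_simps = lie_endo_simps[OF lie_endo_subst]

lemma comp_subst: "lie_endo \<nu> \<Longrightarrow> \<nu> \<circ> subst a b = subst (\<nu> a) (\<nu> b)"
  by (rule lie_endo_eqI) (simp_all add: lie_endo_comp lie_endo_subst)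

lemma lie_endo_eq_subst: "lie_endo \<nu> \<Longrightarrow> \<nu> = subst (\<nu> X) (\<nu> Y)"
  by (rule lie_endo_eqI) (simp_all add: lie_endo_subst)

lemma bracket_zero_left [simp]: "lie_bracket 0 a = 0"
  and bracket_zero_right [simp]: "lie_bracket a 0 = 0"
  using free_lie.bracket_add_left[of 0 0 a] free_lie.bracket_add_right[of a 0 0] by simp_all

lemma bracket_antisym: "lie_bracket b a = - lie_bracket a b"
proof -
  have "0 = lie_bracket (a + b) (a + b)" by (simp only: free_lie.bracket_self)
  also have "\<dots> = lie_bracket a b + lie_bracket b a"
    by (subst free_lie.bracket_add_left)
      (simp add: free_lie.bracket_add_right free_lie.bracket_self)
  finally show ?thesis by (simp add: eq_neg_iff_add_eq_0 add.commute)
qed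

lemma subst_line:
  "\<exists>k. subst (lie_scale \<alpha> b) (lie_scale \<beta> b) a = lie_scale k b"
proof (induction a)
  case (gen g)
  then show ?case by (cases g) auto
next
  case zero
  then show ?case by (auto simp: subst_simps intro: exI[of _ 0])
next
  case (neg a)
  then show ?case by (metis free_lie.scale_minus_left subst_simps(5))
next
  case (add a b)
  then show ?case by (metis free_lie.scale_left_distrib subst_simps(1))
next
  case (scale r a)
  then show ?case by (metis free_lie.scale_scale subst_simps(2))
next
  case (bracket a c)
  then obtain k l where "subst (lie_scale \<alpha> b) (lie_scale \<beta> b) a = lie_scale k b"
    "subst (lie_scale \<alpha> b) (lie_scale \<beta> b) c = lie_scale l b" by auto
  then show ?case
    by (auto simp: subst_simps free_lie.bracket_scale_left free_lie.bracket_scale_right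
        free_lie.bracket_self intro!: exI[of _ 0])
qed

lemma lie_gen_neq_zero: "(lie_gen g :: ('p::field, 'x) free_lie) \<noteq> 0"
proof
  assume 0: "(lie_gen g :: ('p, 'x) free_lie) = 0"
  have "lie_algebra ((*) :: 'p \<Rightarrow> 'p \<Rightarrow> 'p) (\<lambda>_ _. 0)"
    by unfold_locales (simp_all add: algebra_simps)
  from free_lie_universal[OF this, of "\<lambda>_. 1"]
  obtain h :: "('p, 'x) free_lie \<Rightarrow> 'p"
    where h: "lie_hom lie_scale lie_bracket (*) (\<lambda>_ _. 0) h" "h (lie_gen g) = 1" by auto
  from h(1) interpret Vector_Spaces.linear lie_scale "(*)" h by (simp add: lie_hom_def)
  from h(2) 0 show False by (simp add: zero)
qed

section \<open>The grading by degree\<close>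

text \<open>
  The linear span of the Lie monomials of degree \<open>n\<close>.
\<close>

inductive homogeneous :: "nat \<Rightarrow> 'p::field free_lie2 \<Rightarrow> bool" where
  gen: "homogeneous 1 (lie_gen g)"
| zero: "homogeneous n 0"
| add: "homogeneous n a \<Longrightarrow> homogeneous n b \<Longrightarrow> homogeneous n (a + b)"
| scale: "homogeneous n a \<Longrightarrow> homogeneous n (lie_scale r a)"
| bracket: "homogeneous m a \<Longrightarrow> homogeneous n b \<Longrightarrow> homogeneous (m + n) (lie_bracket a b)"

lemma homogeneous_0:
  assumes "homogeneous 0 a"
  shows "a = 0"
proof -
  have "n = 0 \<longrightarrow> a = 0" if "homogeneous n a" for n
    using that by induction auto
  with assms show ?thesis by blast
qed

lemma homogeneous_1:
  assumes "homogeneous 1 a"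
  shows "\<exists>\<alpha> \<beta>. a = lie_scale \<alpha> X + lie_scale \<beta> Y"
proof -
  have "n = 1 \<longrightarrow> (\<exists>\<alpha> \<beta>. a = lie_scale \<alpha> X + lie_scale \<beta> Y)" if "homogeneous n a" for n
    using that
  proof induction
    case (gen g)
    have "X = lie_scale 1 X + lie_scale (0 :: 'a) Y" "Y = lie_scale (0 :: 'a) X + lie_scale 1 Y"
      by simp_all
    then show ?case by (cases g) metis+
  next
    case (zero n)
    have "(0 :: 'a free_lie2) = lie_scale 0 X + lie_scale 0 Y" by simp
    then show ?case by blast
  next
    case (add n a b)
    show ?case
    proof
      assume "n = 1"
      with add obtain \<alpha> \<beta> \<alpha>' \<beta>' where "a = lie_scale \<alpha> X + lie_scale \<beta> Y"
        "b = lie_scale \<alpha>' X + lie_scale \<beta>' Y" by auto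
      then have "a + b = lie_scale (\<alpha> + \<alpha>') X + lie_scale (\<beta> + \<beta>') Y"
        by (simp add: free_lie.scale_left_distrib algebra_simps)
      then show "\<exists>\<alpha> \<beta>. a + b = lie_scale \<alpha> X + lie_scale \<beta> Y" by blast
    qed
  next
    case (scale n a r)
    then show ?case by (metis free_lie.scale_right_distrib free_lie.scale_scale)
  next
    case (bracket m a n b)
    have "lie_bracket a b = 0" if "m + n = 1"
    proof -
      from that have "m = 0 \<or> n = 0" by linarith
      with bracket.hyps show ?thesis by (auto dest: homogeneous_0)
    qed
    moreover have "(0 :: 'a free_lie2) = lie_scale 0 X + lie_scale 0 Y" by simp
    ultimately show ?case by metis
  qed
  with assms show ?thesis by blast
qed

lemma homogeneous_2:
  assumes "homogeneous 2 a"
  shows "\<exists>\<gamma>. a = lie_scale \<gamma> (lie_bracket X Y)"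
proof -
  have "n = 2 \<longrightarrow> (\<exists>\<gamma>. a = lie_scale \<gamma> (lie_bracket X Y))" if "homogeneous n a" for n
    using that
  proof induction
    case (zero n)
    have "(0 :: 'a free_lie2) = lie_scale 0 (lie_bracket X Y)" by simp
    then show ?case by blast
  next
    case (add n a b)
    then show ?case by (metis free_lie.scale_left_distrib)
  next
    case (scale n a r)
    then show ?case by (metis free_lie.scale_scale)
  next
    case (bracket m a n b)
    show ?case
    proof
      assume mn: "m + n = 2"
      show "\<exists>\<gamma>. lie_bracket a b = lie_scale \<gamma> (lie_bracket X Y)"
      proof (cases "m = 1 \<and> n = 1")
        case True
        with bracket.hyps have "homogeneous 1 a" "homogeneous 1 b" by simp_all
        then obtain \<alpha> \<beta> \<alpha>' \<beta>' where "a = lie_scale \<alpha> X + lie_scale \<beta> Y"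
          "b = lie_scale \<alpha>' X + lie_scale \<beta>' Y" by (metis homogeneous_1)
        then have "lie_bracket a b = lie_scale (\<alpha> * \<beta>' - \<beta> * \<alpha>') (lie_bracket X Y)"
          by (simp add: free_lie.bracket_add_left free_lie.bracket_add_right
              free_lie.bracket_scale_left free_lie.bracket_scale_right free_lie.bracket_self
              bracket_antisym[of Y X] free_lie.scale_left_diff_distrib mult.commute)
        then show ?thesis by blast
      next
        case False
        with mn have "m = 0 \<or> n = 0" by linarith
        with bracket.hyps have "lie_bracket a b = lie_scale 0 (lie_bracket X Y)"
          by (auto dest: homogeneous_0)
        then show ?thesis by blast
      qed
    qed
  qed simp
  with assms show ?thesis by blast
qed

text \<open>
  The ideal of all elements without components of degree less than \<open>d\<close>, that is, the \<open>d\<close>-th term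
  of the lower central series if \<open>d \<ge> 1\<close>.
\<close>

definition filtration :: "nat \<Rightarrow> 'p::field free_lie2 set"
  where "filtration d = free_lie.span {a. \<exists>n\<ge>d. homogeneous n a}"

lemma filtration_base: "homogeneous n a \<Longrightarrow> d \<le> n \<Longrightarrow> a \<in> filtration d"
  unfolding filtration_def by (rule free_lie.span_base) auto

lemma filtration_zero: "0 \<in> filtration d"
  and filtration_add: "a \<in> filtration d \<Longrightarrow> b \<in> filtration d \<Longrightarrow> a + b \<in> filtration d"
  and filtration_scale: "a \<in> filtration d \<Longrightarrow> lie_scale r a \<in> filtration d"
  and filtration_uminus: "a \<in> filtration d \<Longrightarrow> - a \<in> filtration d"
  unfolding filtration_def
  by (simp_all add: free_lie.span_zero free_lie.span_add free_lie.span_scale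
      free_lie.span_neg)

lemma filtration_antimono: "d \<le> e \<Longrightarrow> filtration e \<subseteq> filtration d"
  unfolding filtration_def by (rule free_lie.span_mono) (auto intro: order_trans)

lemma filtration_induct [consumes 1, case_names zero add_scale]:
  assumes "a \<in> filtration d" "Q 0"
    and "\<And>r n b c. d \<le> n \<Longrightarrow> homogeneous n b \<Longrightarrow> Q c \<Longrightarrow> Q (lie_scale r b + c)"
  shows "Q a"
  using assms(1) unfolding filtration_def
  by (rule free_lie.span_induct_alt) (use assms in auto)

lemma filtration_bracket:
  assumes "a \<in> filtration m" "b \<in> filtration n"
  shows "lie_bracket a b \<in> filtration (m + n)"
  using assms(1)
proof (induction rule: filtration_induct)
  case (add_scale r i c c')
  have "lie_bracket c b \<in> filtration (m + n)"
    using assms(2)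
  proof (induction rule: filtration_induct)
    case (add_scale q j u v)
    have "lie_bracket c u \<in> filtration (m + n)"
      by (rule filtration_base[OF homogeneous.bracket])
        (use add_scale \<open>homogeneous i c\<close> \<open>m \<le> i\<close> in auto)
    with add_scale show ?case
      by (simp add: free_lie.bracket_add_right free_lie.bracket_scale_right filtration_add
          filtration_scale)
  qed (simp add: filtration_zero)
  with add_scale show ?case
    by (simp add: free_lie.bracket_add_left free_lie.bracket_scale_left filtration_add
        filtration_scale)
qed (simp add: filtration_zero)

lemma filtration_1: "a \<in> filtration 1"
proof (induction a)
  case (gen g)
  show ?case by (rule filtration_base[OF homogeneous.gen]) simp
next
  case (bracket a b)
  then have "lie_bracket a b \<in> filtration (1 + 1)" by (rule filtration_bracket)
  then show ?case using filtration_antimono[of 1 "1 + 1"] by auto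
qed (simp_all add: filtration_zero filtration_add filtration_scale filtration_uminus)

lemma linear_part:
  obtains \<alpha> \<beta> r where "a = lie_scale \<alpha> X + lie_scale \<beta> Y + r" "r \<in> filtration 2"
proof -
  have "\<exists>\<alpha> \<beta> r. a = lie_scale \<alpha> X + lie_scale \<beta> Y + r \<and> r \<in> filtration 2"
    using filtration_1[of a]
  proof (induction rule: filtration_induct)
    case zero
    show ?case by (intro exI[of _ 0]) (simp add: filtration_zero)
  next
    case (add_scale q n b c)
    then obtain \<alpha> \<beta> r where c: "c = lie_scale \<alpha> X + lie_scale \<beta> Y + r" "r \<in> filtration 2"
      by auto
    show ?case
    proof (cases "n = 1")
      case True
      with add_scale homogeneous_1[of b]
      obtain \<alpha>' \<beta>' where "b = lie_scale \<alpha>' X + lie_scale \<beta>' Y" by auto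
      with c have "lie_scale q b + c
          = lie_scale (q * \<alpha>' + \<alpha>) X + lie_scale (q * \<beta>' + \<beta>) Y + r"
        by (simp add: free_lie.scale_left_distrib free_lie.scale_right_distrib algebra_simps)
      with c show ?thesis by blast
    next
      case False
      with add_scale have "b \<in> filtration 2" by (intro filtration_base[of n]) auto
      with c have "lie_scale q b + r \<in> filtration 2"
        by (simp add: filtration_add filtration_scale)
      moreover have "lie_scale q b + c = lie_scale \<alpha> X + lie_scale \<beta> Y + (lie_scale q b + r)"
        using c by (simp add: algebra_simps)
      ultimately show ?thesis by blast
    qed
  qed
  then show thesis using that by blast
qed

text \<open>
  The elements of filtration degree 2 are the linear combinations of brackets.
\<close>

lemma filtration_2_induct [consumes 1, case_names zero add scale bracket]:
  assumes "a \<in> filtration 2" and "Q 0" and "\<And>a b. Q a \<Longrightarrow> Q b \<Longrightarrow> Q (a + b)"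
    and "\<And>r a. Q a \<Longrightarrow> Q (lie_scale r a)" and "\<And>a b. Q (lie_bracket a b)"
  shows "Q a"
proof -
  have "2 \<le> n \<longrightarrow> Q b" if "homogeneous n b" for n b
    using that by induction (simp_all add: assms)
  with assms show ?thesis by (induction rule: filtration_induct) auto
qed

lemma lie_endo_filtration_2:
  assumes "lie_endo \<nu>" "a \<in> filtration 2"
  shows "\<nu> a \<in> filtration 2"
  using assms(2)
proof (induction rule: filtration_2_induct)
  case (bracket a b)
  show ?case using filtration_bracket[OF filtration_1 filtration_1, of "\<nu> a" "\<nu> b"]
    by (simp add: lie_endo_simps[OF assms(1)] numeral_2_eq_2)
qed (simp_all add: lie_endo_simps[OF assms(1)] filtration_zero filtration_add filtration_scale)

lemma filtration_decomposition:
  assumes "a \<in> filtration d"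
  obtains N c where "\<And>n. homogeneous n (c n)" "\<And>n. n < d \<or> N \<le> n \<Longrightarrow> c n = 0"
    "a = (\<Sum>n<N. c n)"
proof -
  have "\<exists>N c. (\<forall>n. homogeneous n (c n)) \<and> (\<forall>n. n < d \<or> N \<le> n \<longrightarrow> c n = 0) \<and> a = (\<Sum>n<N. c n)"
    using assms
  proof (induction rule: filtration_induct)
    case zero
    show ?case by (intro exI[of _ 0] exI[of _ "\<lambda>_. 0"]) (simp add: homogeneous.zero)
  next
    case (add_scale r k b a')
    then obtain N c where c: "\<forall>n. homogeneous n (c n)" "\<forall>n. n < d \<or> N \<le> n \<longrightarrow> c n = 0"
      "a' = (\<Sum>n<N. c n)" by auto
    define c' where "c' n = (if n = k then lie_scale r b else 0) + c n" for n
    define M where "M = max N (Suc k)"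
    have "(\<Sum>n<M. c n) = a'"
      unfolding c(3) by (rule sum.mono_neutral_right) (use c in \<open>auto simp: M_def\<close>)
    moreover have "k < M" by (simp add: M_def)
    ultimately have "(\<Sum>n<M. c' n) = lie_scale r b + a'"
      by (simp add: c'_def sum.distrib sum.delta)
    moreover have "\<forall>n. homogeneous n (c' n)"
      using c add_scale by (auto simp: c'_def intro: homogeneous.intros)
    moreover have "\<forall>n. n < d \<or> M \<le> n \<longrightarrow> c' n = 0"
      using c add_scale by (auto simp: c'_def M_def)
    ultimately show ?case by metis
  qed
  then show thesis using that by blast
qed

text \<open>
  A polynomial with coefficients in a vector space that vanishes on an infinite field has zero
  coefficients: apply a linear functional that does not vanish on the given coefficient.
\<close>

lemma (in vector_space) polynomial_identity_coeffs_zero: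
  assumes "infinite (UNIV :: 'a set)" and "\<And>t. (\<Sum>n<N. t ^ n *s c n) = 0" and "k < N"
  shows "c k = 0"
proof (rule ccontr)
  assume "c k \<noteq> 0"
  interpret K: vector_space "(*) :: 'a \<Rightarrow> 'a \<Rightarrow> 'a"
    by unfold_locales (simp_all add: algebra_simps)
  interpret vector_space_pair scale "(*) :: 'a \<Rightarrow> 'a \<Rightarrow> 'a" ..
  have "independent {c k}" using \<open>c k \<noteq> 0\<close> by simp
  from linear_independent_extend[OF this, of "\<lambda>_. 1"]
  obtain f where f: "Vector_Spaces.linear scale (*) f" "f (c k) = 1" by auto
  interpret Vector_Spaces.linear scale "(*)" f by (rule f(1))
  define p where "p = (\<Sum>n<N. monom (f (c n)) n)"
  have "poly p t = f (\<Sum>n<N. t ^ n *s c n)" for t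
    by (simp add: p_def poly_sum poly_monom sum scale mult.commute)
  then have "{t. poly p t = 0} = UNIV" using assms(2) by (simp add: zero)
  then have "p = 0" using assms(1) poly_roots_finite[of p] by auto
  moreover have "coeff p k = 1"
    using assms(3) f(2) by (simp add: p_def coeff_sum sum.delta)
  ultimately show False by simp
qed

lemma dilation_homogeneous:
  assumes "homogeneous n a"
  shows "subst (lie_scale t X) (lie_scale t Y) a = lie_scale (t ^ n) a"
  using assms
proof induction
  case (gen g)
  then show ?case by (cases g) auto
qed (simp_all add: subst_simps free_lie.scale_right_distrib free_lie.bracket_scale_left
    free_lie.bracket_scale_right power_add mult.commute)

lemma dilation_sum:
  assumes "\<And>n. homogeneous n (c n)"
  shows "subst (lie_scale t X) (lie_scale t Y) (\<Sum>n<N. c n) = (\<Sum>n<N. lie_scale (t ^ n) (c n))"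
  by (induction N) (simp_all add: subst_simps dilation_homogeneous assms)

lemma homogeneous_components_zero:
  fixes c :: "nat \<Rightarrow> 'p::field free_lie2"
  assumes "infinite (UNIV :: 'p set)" and "\<And>n. homogeneous n (c n)"
    and "(\<Sum>n<N. c n) = 0" and "k < N"
  shows "c k = 0"
proof (rule free_lie.polynomial_identity_coeffs_zero[OF assms(1) _ assms(4)])
  fix t
  show "(\<Sum>n<N. lie_scale (t ^ n) (c n)) = 0"
    using dilation_sum[where c = c, OF assms(2), of t N] by (simp add: assms(3) subst_simps)
qed

lemma filtration_separated:
  fixes a :: "'p::field free_lie2"
  assumes "infinite (UNIV :: 'p set)" and "\<And>d. a \<in> filtration d"
  shows "a = 0"
proof -
  obtain N c where c: "\<And>n. homogeneous n (c n)" "\<And>n. n < 0 \<or> N \<le> n \<Longrightarrow> c n = 0"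
    "a = (\<Sum>n<N. c n)" using filtration_decomposition[OF assms(2)[of 0]] by metis
  obtain M b where b: "\<And>n. homogeneous n (b n)" "\<And>n. n < N \<or> M \<le> n \<Longrightarrow> b n = 0"
    "a = (\<Sum>n<M. b n)" using filtration_decomposition[OF assms(2)[of N]] by metis
  define u where "u n = b n + lie_scale (- 1) (c n)" for n
  have "(\<Sum>n<max N M. c n) = a"
    unfolding c(3) by (rule sum.mono_neutral_right) (use c in auto)
  moreover have "(\<Sum>n<max N M. b n) = a"
    unfolding b(3) by (rule sum.mono_neutral_right) (use b in auto)
  ultimately have "(\<Sum>n<max N M. u n) = 0"
    by (simp add: u_def sum_subtractf)
  moreover have "homogeneous n (u n)" for n
    unfolding u_def by (intro homogeneous.intros b c)
  ultimately have u: "u n = 0" if "n < max N M" for n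
    using homogeneous_components_zero[OF assms(1), of u] that by blast
  have "c n = 0" if "n < N" for n
    using u[of n] b(2)[of n] that by (simp add: u_def)
  then show ?thesis by (simp add: c(3))
qed

lemma homogeneous_if_dilation_eigenvector:
  fixes a :: "'p::field free_lie2"
  assumes "infinite (UNIV :: 'p set)"
    and "\<And>t. subst (lie_scale t X) (lie_scale t Y) a = lie_scale (t ^ k) a"
  shows "homogeneous k a"
proof -
  obtain N c where c: "\<And>n. homogeneous n (c n)" "\<And>n. n < 1 \<or> N \<le> n \<Longrightarrow> c n = 0"
    "a = (\<Sum>n<N. c n)" using filtration_decomposition[OF filtration_1] by metis
  define M where "M = max N (Suc k)"
  define u where "u n = c n - (if n = k then a else 0)" for n
  have a: "(\<Sum>n<M. c n) = a"
    unfolding c(3) by (rule sum.mono_neutral_right) (use c in \<open>auto simp: M_def\<close>)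
  have "(\<Sum>n<M. lie_scale (t ^ n) (u n)) = 0" for t
  proof -
    have "(\<Sum>n<M. lie_scale (t ^ n) (if n = k then a else 0))
        = (\<Sum>n<M. if n = k then lie_scale (t ^ k) a else 0)"
      by (rule sum.cong) auto
    moreover have "k < M" by (simp add: M_def)
    ultimately have "(\<Sum>n<M. lie_scale (t ^ n) (u n))
        = (\<Sum>n<M. lie_scale (t ^ n) (c n)) - lie_scale (t ^ k) a"
      by (simp add: u_def free_lie.scale_right_diff_distrib sum_subtractf sum.delta)
    also have "\<dots> = 0"
      using dilation_sum[where c = c, OF c(1), of t M] by (simp add: a assms(2))
    finally show ?thesis .
  qed
  from free_lie.polynomial_identity_coeffs_zero[OF assms(1) this, of k]
  have "c k = a" by (simp add: u_def M_def)
  with c(1)[of k] show ?thesis by simp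
qed

section \<open>Idempotent endomorphisms\<close>

text \<open>
  An idempotent \<open>\<epsilon>\<close> whose linear part kills \<open>w\<close> kills \<open>w\<close> itself, provided that \<open>w\<close> and some \<open>z\<close>
  span the generators. Suppose that \<open>\<epsilon> w\<close> lies
  in degrees at least \<open>d \<ge> 2\<close>. Modulo these degrees the image of \<open>\<epsilon>\<close> is the line through \<open>\<epsilon> z\<close>,
  on which all brackets vanish, so that \<open>\<epsilon>\<close> maps brackets to degrees at least \<open>d + 1\<close>. As
  \<open>\<epsilon> w\<close> is a sum of brackets and is fixed by \<open>\<epsilon>\<close>, it lies in degrees at least \<open>d + 1\<close>.
\<close>

lemma idempotent_kills_nonlinear_kernel:
  fixes w z :: "'p::field free_lie2"
  assumes inf: "infinite (UNIV :: 'p set)" and \<epsilon>: "lie_endo \<epsilon>" "\<epsilon> \<circ> \<epsilon> = \<epsilon>"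
    and w: "\<epsilon> w \<in> filtration 2"
    and span: "\<And>g. \<exists>\<alpha> \<beta>. lie_gen g = lie_scale \<alpha> w + lie_scale \<beta> z"
  shows "\<epsilon> w = 0"
proof (rule filtration_separated[OF inf])
  note \<epsilon>_simps = lie_endo_simps[OF \<epsilon>(1)]
  have step: "\<epsilon> w \<in> filtration (Suc d)" if d: "2 \<le> d" "\<epsilon> w \<in> filtration d" for d
  proof -
    have mod_bracket: "lie_bracket (lie_scale k (\<epsilon> z) + r) (lie_scale l (\<epsilon> z) + q)
        \<in> filtration (Suc d)"
      if "r \<in> filtration d" "q \<in> filtration d" for k l r q
    proof -
      have "lie_bracket r b \<in> filtration (Suc d)" for b
        using filtration_bracket[OF that(1) filtration_1] by simp
      moreover have "lie_bracket b q \<in> filtration (Suc d)" for b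
        using filtration_bracket[OF filtration_1 that(2)] by simp
      ultimately show ?thesis
        by (simp add: free_lie.bracket_add_left free_lie.bracket_add_right
            free_lie.bracket_scale_left free_lie.bracket_scale_right free_lie.bracket_self
            filtration_add filtration_scale filtration_zero)
    qed
    have mod: "\<exists>k r. \<epsilon> a = lie_scale k (\<epsilon> z) + r \<and> r \<in> filtration d" for a
    proof (induction a)
      case (gen g)
      obtain \<alpha> \<beta> where "lie_gen g = lie_scale \<alpha> w + lie_scale \<beta> z" using span by blast
      then have "\<epsilon> (lie_gen g) = lie_scale \<beta> (\<epsilon> z) + lie_scale \<alpha> (\<epsilon> w)"
        by (simp add: \<epsilon>_simps)
      with d show ?case using filtration_scale by blast
    next
      case zero
      show ?case by (intro exI[of _ 0]) (simp add: \<epsilon>_simps filtration_zero)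
    next
      case (neg a)
      then obtain k r where "\<epsilon> a = lie_scale k (\<epsilon> z) + r" "r \<in> filtration d" by auto
      then have "\<epsilon> (- a) = lie_scale (- k) (\<epsilon> z) + (- r)" "- r \<in> filtration d"
        by (simp_all add: \<epsilon>_simps filtration_uminus)
      then show ?case by blast
    next
      case (add a b)
      then obtain k r l q where "\<epsilon> a = lie_scale k (\<epsilon> z) + r" "r \<in> filtration d"
        "\<epsilon> b = lie_scale l (\<epsilon> z) + q" "q \<in> filtration d" by auto
      then have "\<epsilon> (a + b) = lie_scale (k + l) (\<epsilon> z) + (r + q)" "r + q \<in> filtration d"
        by (simp_all add: \<epsilon>_simps filtration_add free_lie.scale_left_distrib algebra_simps)
      then show ?case by blast
    next
      case (scale t a)
      then obtain k r where "\<epsilon> a = lie_scale k (\<epsilon> z) + r" "r \<in> filtration d" by auto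
      then have "\<epsilon> (lie_scale t a) = lie_scale (t * k) (\<epsilon> z) + lie_scale t r"
        "lie_scale t r \<in> filtration d"
        by (simp_all add: \<epsilon>_simps filtration_scale free_lie.scale_right_distrib)
      then show ?case by blast
    next
      case (bracket a b)
      then obtain k r l q where "\<epsilon> a = lie_scale k (\<epsilon> z) + r" "r \<in> filtration d"
        "\<epsilon> b = lie_scale l (\<epsilon> z) + q" "q \<in> filtration d" by auto
      then have "\<epsilon> (lie_bracket a b) \<in> filtration d"
        using mod_bracket filtration_antimono[of d "Suc d"] by (auto simp: \<epsilon>_simps)
      moreover have "\<epsilon> (lie_bracket a b) = lie_scale 0 (\<epsilon> z) + \<epsilon> (lie_bracket a b)"
        by simp
      ultimately show ?case by blast
    qed
    have "\<epsilon> h \<in> filtration (Suc d)" if "h \<in> filtration 2" for h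
      using that
    proof (induction rule: filtration_2_induct)
      case (bracket a b)
      obtain k r l q where "\<epsilon> a = lie_scale k (\<epsilon> z) + r" "r \<in> filtration d"
        "\<epsilon> b = lie_scale l (\<epsilon> z) + q" "q \<in> filtration d" using mod by metis
      then show ?case
        using mod_bracket by (simp add: \<epsilon>_simps)
    qed (simp_all add: \<epsilon>_simps filtration_zero filtration_add filtration_scale)
    from this[OF w] show ?thesis using \<epsilon>(2) by (simp add: fun_eq_iff)
  qed
  fix d
  have "\<epsilon> w \<in> filtration (2 + d)"
    by (induction d) (use w step in auto)
  then show "\<epsilon> w \<in> filtration d" using filtration_antimono[of d "2 + d"] by auto
qed

text \<open>
  If an endomorphism \<open>\<epsilon>\<close> fixes the generators modulo degree 2, then \<open>a \<mapsto> \<epsilon> a - a\<close> raises degrees.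
  If \<open>\<epsilon>\<close> is idempotent, it kills \<open>h = \<epsilon> a - a\<close>, and then
  \<open>\<epsilon> h - h = - h\<close> shows that \<open>h\<close> lies in every degree of the filtration.
\<close>

lemma idempotent_unipotent_eq_id:
  fixes \<epsilon> :: "'p::field free_lie2 \<Rightarrow> 'p free_lie2"
  assumes inf: "infinite (UNIV :: 'p set)" and \<epsilon>: "lie_endo \<epsilon>" "\<epsilon> \<circ> \<epsilon> = \<epsilon>"
    and lin: "\<And>g. \<epsilon> (lie_gen g) - lie_gen g \<in> filtration 2"
  shows "\<epsilon> = id"
proof -
  note \<epsilon>_simps = lie_endo_simps[OF \<epsilon>(1)]
  have hom: "\<epsilon> a - a \<in> filtration (Suc n)" if "homogeneous n a" for n a
    using that
  proof induction
    case (gen g)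
    then show ?case using lin by (simp add: numeral_2_eq_2)
  next
    case (zero n)
    show ?case by (simp add: \<epsilon>_simps filtration_zero)
  next
    case (add n a b)
    have "\<epsilon> (a + b) - (a + b) = (\<epsilon> a - a) + (\<epsilon> b - b)" by (simp add: \<epsilon>_simps)
    with add show ?case by (simp only: filtration_add)
  next
    case (scale n a r)
    then show ?case
      by (simp add: \<epsilon>_simps filtration_scale flip: free_lie.scale_right_diff_distrib)
  next
    case (bracket m a n b)
    have a: "a \<in> filtration m" and b: "b \<in> filtration n"
      using bracket.hyps filtration_base by blast+
    have "\<epsilon> b = (\<epsilon> b - b) + b" by simp
    then have \<epsilon>b: "\<epsilon> b \<in> filtration n"
      using b bracket.IH(2) filtration_antimono[of n "Suc n"] filtration_add
      by (metis le_add2 plus_1_eq_Suc subsetD)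
    have "\<epsilon> (lie_bracket a b) - lie_bracket a b
        = lie_bracket (\<epsilon> a - a) (\<epsilon> b) + lie_bracket a (\<epsilon> b - b)"
      using free_lie.bracket_add_left[of "\<epsilon> a - a" a "\<epsilon> b"]
        free_lie.bracket_add_right[of a "\<epsilon> b - b" b] by (simp add: \<epsilon>_simps)
    then show ?case
      using filtration_bracket[OF bracket.IH(1) \<epsilon>b] filtration_bracket[OF a bracket.IH(2)]
      by (simp add: filtration_add)
  qed
  have step: "\<epsilon> a - a \<in> filtration (Suc d)" if "a \<in> filtration d" for a d
    using that
  proof (induction rule: filtration_induct)
    case zero
    show ?case by (simp add: \<epsilon>_simps filtration_zero)
  next
    case (add_scale r n b c)
    have "\<epsilon> b - b \<in> filtration (Suc d)"
      using hom[OF add_scale(2)] add_scale(1) filtration_antimono[of "Suc d" "Suc n"] by auto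
    moreover have "\<epsilon> (lie_scale r b + c) - (lie_scale r b + c)
        = lie_scale r (\<epsilon> b - b) + (\<epsilon> c - c)"
      by (simp add: \<epsilon>_simps free_lie.scale_right_diff_distrib)
    ultimately show ?case using add_scale(3) by (simp only: filtration_add filtration_scale)
  qed
  have "\<epsilon> a - a = 0" for a
  proof (rule filtration_separated[OF inf])
    fix d
    have "\<epsilon> (\<epsilon> a - a) = 0" using \<epsilon>(2) by (simp add: \<epsilon>_simps fun_eq_iff)
    then show "\<epsilon> a - a \<in> filtration d"
    proof (induction d)
      case 0
      show ?case using filtration_1 filtration_antimono[of 0 1] by auto
    next
      case (Suc d)
      then show ?case using filtration_uminus[OF step[of "\<epsilon> a - a" d]] by simp
    qed
  qed
  then show ?thesis by (auto simp: fun_eq_iff)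
qed

text \<open>
  An idempotent endomorphism other than the identity maps \<open>L\<close> onto a line or to zero (the case
  \<open>b = 0\<close>).
\<close>

lemma idempotent_cases:
  fixes \<epsilon> :: "'p::field free_lie2 \<Rightarrow> 'p free_lie2"
  assumes inf: "infinite (UNIV :: 'p set)" and \<epsilon>: "lie_endo \<epsilon>" "\<epsilon> \<circ> \<epsilon> = \<epsilon>" "\<epsilon> \<noteq> id"
  obtains \<alpha> \<beta> b where "\<epsilon> b = b" "\<epsilon> = subst (lie_scale \<alpha> b) (lie_scale \<beta> b)"
proof -
  note \<epsilon>_simps = lie_endo_simps[OF \<epsilon>(1)]
  have idem: "\<epsilon> (\<epsilon> a) = \<epsilon> a" for a using \<epsilon>(2) by (simp add: fun_eq_iff)
  from idempotent_unipotent_eq_id[OF inf \<epsilon>(1,2)] \<epsilon>(3)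
  obtain g where g: "\<epsilon> (lie_gen g) - lie_gen g \<notin> filtration 2" by blast
  obtain \<alpha> \<beta> r where r: "\<epsilon> (lie_gen g) - lie_gen g = lie_scale \<alpha> X + lie_scale \<beta> Y + r"
    "r \<in> filtration 2" by (rule linear_part)
  define w where "w = lie_scale \<alpha> X + lie_scale \<beta> Y"
  \<comment> \<open>The element \<open>w + r\<close> is in the kernel, and \<open>w\<close> is its nonzero linear part.\<close>
  have "\<epsilon> (w + r) = 0" using r(1) idem by (metis \<epsilon>_simps(6) diff_self w_def)
  then have "\<epsilon> w = - \<epsilon> r" by (simp add: \<epsilon>_simps eq_neg_iff_add_eq_0)
  then have w: "\<epsilon> w \<in> filtration 2"
    using lie_endo_filtration_2[OF \<epsilon>(1) r(2)] filtration_uminus by simp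
  have "\<alpha> \<noteq> 0 \<or> \<beta> \<noteq> 0" using g r by auto
  then have "\<exists>z. \<forall>g. \<exists>k l. lie_gen g = lie_scale k w + lie_scale l z"
  proof
    assume "\<alpha> \<noteq> 0"
    then have X: "X = lie_scale (1 / \<alpha>) w + lie_scale (- \<beta> / \<alpha>) Y"
      by (simp add: w_def free_lie.scale_right_distrib)
    have Y: "Y = lie_scale 0 w + lie_scale 1 Y" by simp
    have "\<exists>k l. lie_gen g = lie_scale k w + lie_scale l Y" for g
      using X Y by (cases g) blast+
    then show ?thesis by blast
  next
    assume "\<beta> \<noteq> 0"
    then have Y: "Y = lie_scale (1 / \<beta>) w + lie_scale (- \<alpha> / \<beta>) X"
      by (simp add: w_def free_lie.scale_right_distrib)
    have X: "X = lie_scale 0 w + lie_scale 1 X" by simp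
    have "\<exists>k l. lie_gen g = lie_scale k w + lie_scale l X" for g
      using X Y by (cases g) blast+
    then show ?thesis by blast
  qed
  then obtain z where z: "\<And>g. \<exists>k l. lie_gen g = lie_scale k w + lie_scale l z" by blast
  have "\<epsilon> w = 0" by (rule idempotent_kills_nonlinear_kernel[OF inf \<epsilon>(1,2) w z])
  then have "\<exists>l. \<epsilon> (lie_gen g) = lie_scale l (\<epsilon> z)" for g
    using z[of g] by (auto simp: \<epsilon>_simps)
  then obtain k l where "\<epsilon> X = lie_scale k (\<epsilon> z)" "\<epsilon> Y = lie_scale l (\<epsilon> z)" by metis
  then show thesis using lie_endo_eq_subst[OF \<epsilon>(1)] that[of "\<epsilon> z" k l] idem by simp
qed

section \<open>Automorphisms of the endomorphism semigroup\<close>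

lemma
  fixes \<phi> :: "('p::field free_lie2 \<Rightarrow> 'p free_lie2) \<Rightarrow> ('p free_lie2 \<Rightarrow> 'p free_lie2)"
  assumes \<phi>: "\<phi> \<in> iso End_free_lie2 End_free_lie2"
  shows End_iso_endo: "lie_endo \<nu> \<Longrightarrow> lie_endo (\<phi> \<nu>)"
    and End_iso_comp: "lie_endo \<nu> \<Longrightarrow> lie_endo \<mu> \<Longrightarrow> \<phi> (\<nu> \<circ> \<mu>) = \<phi> \<nu> \<circ> \<phi> \<mu>"
    and End_iso_inj: "lie_endo \<nu> \<Longrightarrow> lie_endo \<mu> \<Longrightarrow> \<phi> \<nu> = \<phi> \<mu> \<Longrightarrow> \<nu> = \<mu>"
    and End_iso_surj: "lie_endo \<mu> \<Longrightarrow> \<exists>\<nu>. lie_endo \<nu> \<and> \<phi> \<nu> = \<mu>"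
proof -
  let ?E = "{\<nu>. lie_endo \<nu>}"
  have E: "carrier End_free_lie2 = ?E" and M: "\<nu> \<otimes>\<^bsub>End_free_lie2\<^esub> \<mu> = \<nu> \<circ> \<mu>"
    for \<nu> \<mu> :: "'p free_lie2 \<Rightarrow> 'p free_lie2"
    by (simp_all add: lie_End_def)
  have bij: "bij_betw \<phi> ?E ?E" using \<phi> unfolding iso_def E by blast
  show "lie_endo (\<phi> \<nu>)" if "lie_endo \<nu>" using bij_betwE[OF bij] that by blast
  show "\<phi> (\<nu> \<circ> \<mu>) = \<phi> \<nu> \<circ> \<phi> \<mu>" if "lie_endo \<nu>" "lie_endo \<mu>"
    using hom_mult[of \<phi> End_free_lie2 End_free_lie2 \<nu> \<mu>] \<phi> that
    unfolding iso_def M E by simp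
  show "\<nu> = \<mu>" if "lie_endo \<nu>" "lie_endo \<mu>" "\<phi> \<nu> = \<phi> \<mu>"
    using inj_on_eq_iff[OF bij_betw_imp_inj_on[OF bij], of \<nu> \<mu>] that by simp
  show "\<exists>\<nu>. lie_endo \<nu> \<and> \<phi> \<nu> = \<mu>" if "lie_endo \<mu>"
  proof -
    have "\<mu> \<in> \<phi> ` ?E" using bij_betw_imp_surj_on[OF bij] that by simp
    then show ?thesis by (elim imageE) auto
  qed
qed

lemma automorphism_induced_by_bijection:
  fixes \<phi> :: "('p::field free_lie2 \<Rightarrow> 'p free_lie2) \<Rightarrow> ('p free_lie2 \<Rightarrow> 'p free_lie2)"
  assumes inf: "infinite (UNIV :: 'p set)"
    and \<phi>: "\<phi> \<in> iso End_free_lie2 End_free_lie2"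
  shows "\<exists>s. bij s \<and> (\<forall>\<nu> a. lie_endo \<nu> \<longrightarrow> \<phi> \<nu> (s a) = s (\<nu> a))"
proof -
  note endo = End_iso_endo[OF \<phi>] and mult = End_iso_comp[OF \<phi>]
    and inj = End_iso_inj[OF \<phi>] and surj = End_iso_surj[OF \<phi>]
  have \<phi>_id: "\<phi> id = id"
  proof -
    obtain \<iota> where \<iota>: "lie_endo \<iota>" "\<phi> \<iota> = id" using surj lie_endo_id by blast
    then show ?thesis using mult[OF lie_endo_id \<iota>(1)] by simp
  qed
  have \<phi>_0: "\<phi> (\<lambda>_. 0) = (\<lambda>_. 0)"
  proof -
    obtain \<zeta> where \<zeta>: "lie_endo \<zeta>" "\<phi> \<zeta> = (\<lambda>_. 0)" using surj lie_endo_const_zero by blast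
    have "\<phi> (\<lambda>_. 0) = \<phi> (\<zeta> \<circ> (\<lambda>_. 0))" by (simp add: lie_endo_zero \<zeta>(1) comp_def)
    also have "\<dots> = (\<lambda>_. 0)"
      unfolding mult[OF \<zeta>(1) lie_endo_const_zero] \<zeta>(2) by (simp add: comp_def)
    finally show ?thesis .
  qed
  define e :: "'p free_lie2 \<Rightarrow> 'p free_lie2" where "e = subst X 0"
  have e: "lie_endo e" "e X = X" "e Y = 0" by (simp_all add: e_def lie_endo_subst)
  have idem: "e \<circ> e = e"
    unfolding e_def by (subst comp_subst) (simp_all add: lie_endo_subst subst_simps)
  have "\<phi> e \<noteq> id" using inj[OF e(1) lie_endo_id] \<phi>_id e(3) lie_gen_neq_zero[of GenY]
    by (metis id_apply)
  moreover have "\<phi> e \<circ> \<phi> e = \<phi> e" using mult[OF e(1) e(1)] idem by simp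
  ultimately obtain \<alpha> \<beta> b where b: "\<phi> e b = b" "\<phi> e = subst (lie_scale \<alpha> b) (lie_scale \<beta> b)"
    using idempotent_cases[OF inf endo[OF e(1)]] by metis
  have "b \<noteq> 0"
  proof
    assume "b = 0"
    then have "\<phi> e = (\<lambda>_. 0)" unfolding b(2)
      by (intro lie_endo_eqI lie_endo_subst lie_endo_const_zero) auto
    then show False using inj[OF e(1) lie_endo_const_zero] \<phi>_0 e(2) lie_gen_neq_zero by metis
  qed
  have \<phi>_subst: "\<phi> (subst a 0) \<circ> \<phi> e = \<phi> (subst a 0)" for a
    using mult[OF lie_endo_subst[of a 0] e(1)] comp_subst[OF lie_endo_subst, of a 0 X 0]
    by (simp add: e_def subst_simps)
  define s where "s a = \<phi> (subst a 0) b" for a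
  have equivariant: "\<phi> \<nu> (s a) = s (\<nu> a)" if \<nu>: "lie_endo \<nu>" for \<nu> a
    using mult[OF \<nu> lie_endo_subst[of a 0]] comp_subst[OF \<nu>, of a 0]
    by (simp add: s_def lie_endo_zero[OF \<nu>] fun_eq_iff)
  have "inj s"
  proof (rule injI)
    fix a c assume "s a = s c"
    then have "\<phi> (subst a 0) \<circ> \<phi> e = \<phi> (subst c 0) \<circ> \<phi> e"
      unfolding b(2) comp_subst[OF endo[OF lie_endo_subst]]
      by (simp add: s_def lie_endo_scale endo lie_endo_subst)
    then have "\<phi> (subst a 0) = \<phi> (subst c 0)" by (simp only: \<phi>_subst)
    then have "subst a 0 = subst c 0" by (rule inj[OF lie_endo_subst lie_endo_subst])
    then show "a = c" by (metis subst_X)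
  qed
  moreover have "\<exists>a. s a = c" for c
  proof -
    \<comment> \<open>The endomorphism \<open>\<mu> = (\<alpha>c, \<beta>c)\<close> maps \<open>b\<close> to \<open>c\<close> and lies in \<open>End(L) \<phi>(e)\<close>.\<close>
    define \<mu> where "\<mu> = subst c 0 \<circ> subst (lie_scale \<alpha> X) (lie_scale \<beta> X)"
    have \<mu>: "lie_endo \<mu>" by (simp add: \<mu>_def lie_endo_comp lie_endo_subst)
    have "subst b 0 \<circ> subst (lie_scale \<alpha> X) (lie_scale \<beta> X) = \<phi> e"
      unfolding b(2) by (subst comp_subst) (simp_all add: lie_endo_subst subst_simps)
    moreover obtain k where k: "subst (lie_scale \<alpha> X) (lie_scale \<beta> X) b = lie_scale k X"
      using subst_line by blast
    ultimately have "lie_scale k b = lie_scale 1 b"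
      using b(1) by (metis comp_apply free_lie.scale_one subst_X subst_simps(2))
    then have "k = 1" using \<open>b \<noteq> 0\<close> by (simp only: free_lie.scale_cancel_right) simp
    then have \<mu>b: "\<mu> b = c" by (simp add: \<mu>_def k subst_simps)
    have \<mu>e: "\<mu> \<circ> \<phi> e = \<mu>" unfolding b(2)
      by (rule lie_endo_eqI)
        (simp_all add: lie_endo_comp lie_endo_subst \<mu> lie_endo_simps[OF \<mu>] \<mu>b,
         simp_all add: \<mu>_def subst_simps)
    obtain \<kappa> where \<kappa>: "lie_endo \<kappa>" "\<phi> \<kappa> = \<mu>" using surj \<mu> by blast
    have "\<kappa> \<circ> e = \<kappa>"
      using inj[OF lie_endo_comp[OF \<kappa>(1) e(1)] \<kappa>(1)] mult[OF \<kappa>(1) e(1)] \<kappa>(2) \<mu>e by simp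
    then have "\<kappa> = subst (\<kappa> X) 0"
      using comp_subst[OF \<kappa>(1), of X 0] by (simp add: e_def lie_endo_zero[OF \<kappa>(1)])
    then have "s (\<kappa> X) = c" using \<kappa>(2) \<mu>b by (simp add: s_def)
    then show ?thesis by blast
  qed
  ultimately have "bij s" by (metis bijI surjI)
  with equivariant show ?thesis by blast
qed

text \<open>
  A bijection of \<open>L\<close> that fixes the generators and normalises \<open>End(L)\<close>, conjugating \<open>(a, b)\<close> to
  \<open>(s(a), s(b))\<close>, is semi-linear, and a scalar multiple of it also preserves brackets.
\<close>

lemma normalising_bijection_semi_automorphism:
  fixes s :: "'p::field free_lie2 \<Rightarrow> 'p free_lie2"
  assumes inf: "infinite (UNIV :: 'p set)" and bij: "bij s" and gens: "s X = X" "s Y = Y"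
    and conj: "\<And>a b c. s (subst a b c) = subst (s a) (s b) (s c)"
  shows "\<exists>\<sigma> c. c \<noteq> 0 \<and>
    lie_semi_automorphism lie_scale lie_bracket \<sigma> (\<lambda>a. lie_scale c (s a))"
proof -
  have s_eq: "s a = s b \<longleftrightarrow> a = b" for a b using bij by (simp add: bij_is_inj inj_eq)
  have s_0: "s 0 = 0"
  proof -
    obtain a where "s a = 0" using bij by (metis bij_pointE)
    moreover have "subst 0 0 = (\<lambda>_. 0 :: 'p free_lie2)"
      by (rule lie_endo_eqI) (simp_all add: lie_endo_subst lie_endo_const_zero)
    ultimately show ?thesis using conj[of 0 0 a] subst_simps(4)[of "s 0" "s 0"] by simp
  qed
  have line: "\<exists>k. subst X 0 a = lie_scale k X" for a :: "'p free_lie2"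
    using subst_line[of 1 X 0 a] by simp
  have s_line: "\<exists>k. s (lie_scale t X) = lie_scale k X" for t
    using conj[of X 0 "lie_scale t X"] line[of "s (lie_scale t X)"]
    by (simp add: subst_simps gens s_0)
  then obtain \<sigma> where \<sigma>: "\<And>t. s (lie_scale t X) = lie_scale (\<sigma> t) X" by metis
  have scale_X: "lie_scale t X = lie_scale u X \<longleftrightarrow> t = u" for t u :: 'p
    by (simp add: lie_gen_neq_zero)
  have s_scale: "s (lie_scale t a) = lie_scale (\<sigma> t) (s a)" for t a
    using conj[of a 0 "lie_scale t X"] by (simp add: subst_simps \<sigma> s_0)
  have \<sigma>_1: "\<sigma> 1 = 1" using \<sigma>[of 1] scale_X[of "\<sigma> 1" 1] by (simp add: gens)
  have \<sigma>_mult: "\<sigma> (t * u) = \<sigma> t * \<sigma> u" for t u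
    using s_scale[of t "lie_scale u X"] by (simp add: \<sigma> lie_gen_neq_zero)
  have "inj \<sigma>" by (rule injI) (metis \<sigma> s_eq scale_X)
  have \<sigma>_surj: "\<exists>u. \<sigma> u = t" for t
  proof -
    obtain a where a: "s a = lie_scale t X" using bij by (metis bij_pointE)
    have "s (subst X 0 a) = s a" using conj[of X 0 a] by (simp add: a gens s_0 subst_simps)
    then obtain u where "a = lie_scale u X" using line[of a] by (auto simp: s_eq)
    then show ?thesis using a by (auto simp: \<sigma> lie_gen_neq_zero)
  qed
  have bij_\<sigma>: "bij \<sigma>" using \<open>inj \<sigma>\<close> \<sigma>_surj by (metis bijI surjI)

  \<comment> \<open>As \<open>\<sigma>\<close> is surjective, \<open>s (X + Y)\<close> is an eigenvector of all dilations.\<close>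
  have "homogeneous 1 (s (X + Y))"
  proof (rule homogeneous_if_dilation_eigenvector[OF inf])
    fix t
    obtain u where u: "\<sigma> u = t" using \<sigma>_surj by blast
    show "subst (lie_scale t X) (lie_scale t Y) (s (X + Y)) = lie_scale (t ^ 1) (s (X + Y))"
      using conj[of "lie_scale u X" "lie_scale u Y" "X + Y"] s_scale[of u "X + Y"]
      by (simp add: subst_simps s_scale gens u free_lie.scale_right_distrib)
  qed
  then obtain \<alpha> \<beta> where p: "s (X + Y) = lie_scale \<alpha> X + lie_scale \<beta> Y"
    using homogeneous_1 by blast
  have "lie_scale \<alpha> X = X"
    using conj[of X 0 "X + Y"] by (simp add: p subst_simps gens s_0)
  moreover have "lie_scale \<beta> Y = Y"
    using conj[of 0 Y "X + Y"] by (simp add: p subst_simps gens s_0)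
  ultimately have s_add: "s (a + b) = s a + s b" for a b
    using conj[of a b "X + Y"] by (simp add: p subst_simps)
  have \<sigma>_add: "\<sigma> (t + u) = \<sigma> t + \<sigma> u" for t u
    using s_add[of "lie_scale t X" "lie_scale u X"]
    by (simp add: \<sigma> lie_gen_neq_zero flip: free_lie.scale_left_distrib)

  have "homogeneous 2 (s (lie_bracket X Y))"
  proof (rule homogeneous_if_dilation_eigenvector[OF inf])
    fix t
    obtain u where u: "\<sigma> u = t" using \<sigma>_surj by blast
    show "subst (lie_scale t X) (lie_scale t Y) (s (lie_bracket X Y))
        = lie_scale (t ^ 2) (s (lie_bracket X Y))"
      using conj[of "lie_scale u X" "lie_scale u Y" "lie_bracket X Y"]
      by (simp add: subst_simps s_scale \<sigma>_mult gens u free_lie.bracket_scale_left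
          free_lie.bracket_scale_right power2_eq_square)
  qed
  then obtain c' where c': "s (lie_bracket X Y) = lie_scale c' (lie_bracket X Y)"
    using homogeneous_2 by blast
  \<comment> \<open>If \<open>c'\<close> were zero, then \<open>[x, y] = 0\<close> by injectivity, and \<open>c = 1\<close> serves as well.\<close>
  obtain c where c: "c \<noteq> 0" "s (lie_bracket X Y) = lie_scale c (lie_bracket X Y)"
  proof (cases "c' = 0")
    case True
    with c' have "lie_bracket X Y = (0 :: 'p free_lie2)" using s_eq[of _ 0] s_0 by simp
    then show thesis using that[of 1] s_0 by simp
  qed (use c' that in blast)
  have s_bracket: "s (lie_bracket a b) = lie_scale c (lie_bracket (s a) (s b))" for a b
    using conj[of a b "lie_bracket X Y"] by (simp add: c(2) subst_simps)
  have "bij (\<lambda>a. lie_scale c (s a))"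
  proof (rule bijI)
    show "inj (\<lambda>a. lie_scale c (s a))"
      by (rule injI) (simp add: free_lie.scale_cancel_left c(1) s_eq)
    have "lie_scale c (s (inv_into UNIV s (lie_scale (1 / c) a))) = a" for a
      using bij c(1) by (simp add: bij_is_surj surj_f_inv_f)
    then show "surj (\<lambda>a. lie_scale c (s a))" by (rule surjI)
  qed
  then have "lie_semi_automorphism lie_scale lie_bracket \<sigma> (\<lambda>a. lie_scale c (s a))"
    unfolding lie_semi_automorphism_def field_automorphism_def
    using bij_\<sigma> \<sigma>_1 \<sigma>_add \<sigma>_mult
    by (simp add: s_add s_bracket s_scale free_lie.scale_right_distrib
        free_lie.bracket_scale_left free_lie.bracket_scale_right mult.commute)
  then show ?thesis using c(1) by blast
qed

theorem theorem2:
  fixes \<phi> :: "('p::field free_lie2 \<Rightarrow> 'p free_lie2) \<Rightarrow> ('p free_lie2 \<Rightarrow> 'p free_lie2)"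
  assumes "infinite (UNIV :: 'p set)"
    and "\<phi> \<in> iso End_free_lie2 End_free_lie2"
  shows "\<exists>\<sigma> s. lie_semi_automorphism lie_scale lie_bracket \<sigma> s \<and>
    (\<forall>\<nu> \<in> carrier End_free_lie2. \<phi> \<nu> = s \<circ> \<nu> \<circ> inv_into UNIV s)"
proof -
  obtain s where s: "bij s" "\<And>\<nu> a. lie_endo \<nu> \<Longrightarrow> \<phi> \<nu> (s a) = s (\<nu> a)"
    using automorphism_induced_by_bijection[OF assms] by blast
  note endo = End_iso_endo[OF assms(2)] and surj = End_iso_surj[OF assms(2)]
  have s_eq: "s a = s b \<longleftrightarrow> a = b" for a b using s(1) by (simp add: bij_is_inj inj_eq)
  have s_onto: "\<exists>a. s a = b" for b using s(1) by (metis bij_pointE)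
  \<comment> \<open>An endomorphism is determined by its values at \<open>s X\<close> and \<open>s Y\<close>, since \<open>s\<close> conjugates the
    endomorphisms bijectively to endomorphisms.\<close>
  have basis_unique: "\<mu> = \<mu>'"
    if "lie_endo \<mu>" "lie_endo \<mu>'" "\<mu> (s X) = \<mu>' (s X)" "\<mu> (s Y) = \<mu>' (s Y)" for \<mu> \<mu>'
  proof -
    obtain \<nu> \<nu>' where \<nu>: "lie_endo \<nu>" "\<phi> \<nu> = \<mu>" "lie_endo \<nu>'" "\<phi> \<nu>' = \<mu>'"
      using surj \<open>lie_endo \<mu>\<close> \<open>lie_endo \<mu>'\<close> by metis
    with that s have "\<nu> X = \<nu>' X" "\<nu> Y = \<nu>' Y" by (metis s_eq)+
    with \<nu> show ?thesis using lie_endo_eqI by metis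
  qed
  \<comment> \<open>Hence \<open>s X\<close> and \<open>s Y\<close> are free generators: \<open>A\<close> is an automorphism with inverse \<open>B\<close>.\<close>
  define A where "A = subst (s X) (s Y)"
  obtain a b where ab: "s a = X" "s b = Y" using s_onto by metis
  define B where "B = \<phi> (subst a b)"
  have A: "lie_endo A" and B: "lie_endo B" by (simp_all add: A_def B_def lie_endo_subst endo)
  have B_gens: "B (s X) = X" "B (s Y) = Y" by (simp_all add: B_def s lie_endo_subst ab)
  have BA: "B (A c) = c" for c
    using lie_endo_eqI[OF lie_endo_comp[OF B A] lie_endo_id] B_gens
    by (simp add: A_def fun_eq_iff)
  have AB: "A (B c) = c" for c
    using basis_unique[OF lie_endo_comp[OF A B] lie_endo_id] B_gens
    by (simp add: A_def fun_eq_iff)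
  define s1 where "s1 c = B (s c)" for c
  have s1: "s1 X = X" "s1 Y = Y" by (simp_all add: s1_def B_gens)
  have bij_B: "bij B" using AB BA by (metis bijI')
  have bij_s1: "bij s1" using bij_comp[OF s(1) bij_B] by (simp add: s1_def[abs_def] comp_def)
  have conj: "s1 (subst u v c) = subst (s1 u) (s1 v) (s1 c)" for u v c
  proof -
    have "B \<circ> \<phi> (subst u v) \<circ> A = subst (s1 u) (s1 v)"
      by (rule lie_endo_eqI)
        (simp_all add: lie_endo_comp lie_endo_subst A B endo s1_def,
         simp_all add: A_def s lie_endo_subst)
    then show ?thesis by (metis AB comp_apply lie_endo_subst s(2) s1_def)
  qed
  obtain \<sigma> k where k: "k \<noteq> 0"
    "lie_semi_automorphism lie_scale lie_bracket \<sigma> (\<lambda>a. lie_scale k (s1 a))"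
    using normalising_bijection_semi_automorphism[OF assms(1) bij_s1 s1 conj] by blast
  define S where "S c = A (lie_scale k (s1 c))" for c
  have "bij A" using AB BA by (metis bijI')
  then have "bij S" using k(2) bij_comp[of "\<lambda>a. lie_scale k (s1 a)" A]
    by (simp add: S_def[abs_def] lie_semi_automorphism_def comp_def)
  with k(2) have S: "lie_semi_automorphism lie_scale lie_bracket \<sigma> S"
    by (simp add: lie_semi_automorphism_def S_def lie_endo_simps[OF A])
  have S_eq: "S c = lie_scale k (s c)" for c
    by (simp add: S_def s1_def lie_endo_scale[OF A] AB)
  have "\<phi> \<nu> = S \<circ> \<nu> \<circ> inv_into UNIV S" if \<nu>: "lie_endo \<nu>" for \<nu>
  proof
    fix c
    have "S (\<nu> (inv_into UNIV S c)) = \<phi> \<nu> (S (inv_into UNIV S c))"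
      by (simp add: S_eq lie_endo_scale endo \<nu> s)
    then show "\<phi> \<nu> c = (S \<circ> \<nu> \<circ> inv_into UNIV S) c"
      using \<open>bij S\<close> by (simp add: bij_is_surj surj_f_inv_f)
  qed
  with S show ?thesis by (auto simp: carrier_End)
qed

end
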